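(* Let $A_1B_1C_1$ and $A_2B_2C_2$ be two triangles. Then the following statements are equivalent: (i) $A_1B_1C_1$ and $A_2B_2C_2$ are perspective from a point. (ii) $A_1B_1C_1$ and $A_2B_2C_2$ are perspective from a line. (iii) $\operatorname{CR}(A_1,B_2;A_1',B_2')=\operatorname{CR}(A_2,B_1;A_2',B_1')$, where $A_1'=(A_1\times B_2)\times(B_1\times C_1)$, $B_1'=(A_2\times B_1)\times(A_1\times C_1)$, $A_2'=(A_2\times B_1)\times(B_2\times C_2)$, $B_2'=(A_1\times B_2)\times(A_2\times C_2)$. (iv) $\operatorname{CR}(B_1,C_2;B_1',C_2')=\operatorname{CR}(B_2,C_1;B_2',C_1')$, where $B_1'=(B_1\times C_2)\times(C_1\times A_1)$, $C_1'=(B_2\times C_1)\times(B_1\times A_1)$, $B_2'=(B_2\times C_1)\times(C_2\times A_2)$, $C_2'=(B_1\times C_2)\times(B_2\times A_2)$. (v) $\operatorname{CR}(C_1,A_2;C_1',A_2')=\operatorname{CR}(C_2,A_1;C_2',A_1')$, where $C_1'=(C_1\times A_2)\times(A_1\times B_1)$, $A_1'=(C_2\times A_1)\times(C_1\times B_1)$, $C_2'=(C_2\times A_1)\times(A_2\times B_2)$, $A_2'=(C_1\times A_2)\times(C_2\times B_2)$. (The primed points are defined separately in each of (iii), (iv), (v).)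
   Context: The setting is the projective plane. $A\times B$ denotes the line through the points $A$ and $B$, and $g\times h$ the intersection point of the lines $g$ and $h$. The cross-ratio of four collinear points is $\operatorname{CR}(A,B;C,D)=\frac{AC}{CB}\cdot\frac{BD}{DA}$, where the fractions are quotients of oriented lengths of segments on an oriented line. The two triangles are perspective from a point if the lines $A_1\times A_2$, $B_1\times B_2$, $C_1\times C_2$ are concurrent, and perspective from a line if the points $(A_1\times B_1)\times(A_2\times B_2)$, $(B_1\times C_1)\times(B_2\times C_2)$, $(C_1\times A_1)\times(C_2\times A_2)$ are collinear. *)

theory Defs
  imports "HOL-Analysis.Analysis"
begin

text \<open>
  The real projective plane: points and lines are the one- and two-dimensional linear subspaces
  of \<open>real ^ 3\<close>.
\<close>

typedef proj_point = "{S :: (real ^ 3) set. subspace S \<and> dim S = 1}"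
  morphisms point_space Abs_proj_point
proof -
  have "dim (span {axis 1 1 :: real ^ 3}) = 1"
    by (simp add: axis_eq_0_iff dim_eq_card_independent)
  then show ?thesis
    using subspace_span by blast
qed

typedef proj_line = "{S :: (real ^ 3) set. subspace S \<and> dim S = 2}"
  morphisms line_space Abs_proj_line
proof -
  have "independent {axis 1 1, axis 2 1 :: real ^ 3}"
    by (rule independent_mono[OF independent_Basis]) (auto simp: Basis_vec_def)
  moreover have "axis 1 1 \<noteq> (axis 2 1 :: real ^ 3)"
    by (simp add: axis_eq_axis)
  ultimately have "dim (span {axis 1 1, axis 2 1 :: real ^ 3}) = 2"
    by (simp add: dim_eq_card_independent)
  then show ?thesis
    using subspace_span by blast
qed

definition on_line :: "proj_point \<Rightarrow> proj_line \<Rightarrow> bool" where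
  "on_line P g \<longleftrightarrow> point_space P \<subseteq> line_space g"

text \<open>
  \<open>join A B\<close> is the line through \<open>A\<close> and \<open>B\<close>, and \<open>meet g h\<close> the common point of \<open>g\<close> and \<open>h\<close>.
  They are meaningful for \<open>A \<noteq> B\<close> and \<open>g \<noteq> h\<close> only; otherwise the subspace has the wrong dimension
  and the value is unspecified.
\<close>

definition join :: "proj_point \<Rightarrow> proj_point \<Rightarrow> proj_line" where
  "join A B = Abs_proj_line (span (point_space A \<union> point_space B))"

definition meet :: "proj_line \<Rightarrow> proj_line \<Rightarrow> proj_point" where
  "meet g h = Abs_proj_point (line_space g \<inter> line_space h)"

definition collinear_points :: "proj_point \<Rightarrow> proj_point \<Rightarrow> proj_point \<Rightarrow> bool" where
  "collinear_points A B C \<longleftrightarrow> (\<exists>g. on_line A g \<and> on_line B g \<and> on_line C g)"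

definition concurrent_lines :: "proj_line \<Rightarrow> proj_line \<Rightarrow> proj_line \<Rightarrow> bool" where
  "concurrent_lines g h k \<longleftrightarrow> (\<exists>P. on_line P g \<and> on_line P h \<and> on_line P k)"

definition is_triangle :: "proj_point \<Rightarrow> proj_point \<Rightarrow> proj_point \<Rightarrow> bool" where
  "is_triangle A B C \<longleftrightarrow> \<not> collinear_points A B C"

definition perspective_from_point ::
  "proj_point \<Rightarrow> proj_point \<Rightarrow> proj_point \<Rightarrow> proj_point \<Rightarrow> proj_point \<Rightarrow> proj_point \<Rightarrow> bool" where
  "perspective_from_point A1 B1 C1 A2 B2 C2 \<longleftrightarrow>
     concurrent_lines (join A1 A2) (join B1 B2) (join C1 C2)"

definition perspective_from_line ::
  "proj_point \<Rightarrow> proj_point \<Rightarrow> proj_point \<Rightarrow> proj_point \<Rightarrow> proj_point \<Rightarrow> proj_point \<Rightarrow> bool" where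
  "perspective_from_line A1 B1 C1 A2 B2 C2 \<longleftrightarrow>
     collinear_points (meet (join A1 B1) (join A2 B2))
                      (meet (join B1 C1) (join B2 C2))
                      (meet (join C1 A1) (join C2 A2))"

text \<open>
  A nonzero vector \<open>f\<close> determines the affine plane \<open>{v. f \<bullet> v = 1}\<close>, whose line at infinity is
  \<open>{v. f \<bullet> v = 0}\<close>; for \<open>f = axis 3 1\<close> it is the usual Euclidean plane of points \<open>(x, y, 1)\<close>.
\<close>

definition finite_point :: "real ^ 3 \<Rightarrow> proj_point \<Rightarrow> bool" where
  "finite_point f P \<longleftrightarrow> (\<exists>v \<in> point_space P. f \<bullet> v = 1)"

definition affine_point :: "real ^ 3 \<Rightarrow> proj_point \<Rightarrow> real ^ 3" where
  "affine_point f P = (THE v. v \<in> point_space P \<and> f \<bullet> v = 1)"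

text \<open>The oriented length of the segment \<open>XY\<close> on a line oriented by the unit vector \<open>u\<close>.\<close>

definition oriented_length :: "real ^ 3 \<Rightarrow> real ^ 3 \<Rightarrow> real ^ 3 \<Rightarrow> real" where
  "oriented_length u X Y = (Y - X) \<bullet> u"

definition unit_direction :: "real ^ 3 \<Rightarrow> (real ^ 3) set \<Rightarrow> bool" where
  "unit_direction u S \<longleftrightarrow> norm u = 1 \<and> (\<forall>X\<in>S. \<forall>Y\<in>S. \<exists>t. Y - X = t *\<^sub>R u)"

text \<open>
  The value \<open>AC/CB \<cdot> BD/DA\<close> for affine points; \<open>None\<close> stands for the value \<open>\<infinity>\<close>, taken when a
  denominator vanishes (a single, unsigned infinity). If \<open>A \<noteq> B\<close>, \<open>C \<noteq> A\<close> and \<open>D \<noteq> B\<close>, no numerator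
  vanishes, so that no indeterminate form is given this value.
\<close>

definition affine_cross_ratio ::
  "real ^ 3 \<Rightarrow> real ^ 3 \<Rightarrow> real ^ 3 \<Rightarrow> real ^ 3 \<Rightarrow> real ^ 3 \<Rightarrow> real option" where
  "affine_cross_ratio u A B C D =
     (if oriented_length u C B = 0 \<or> oriented_length u D A = 0 then None
      else Some ((oriented_length u A C / oriented_length u C B) *
                 (oriented_length u B D / oriented_length u D A)))"

text \<open>
  Some of the four points may be at infinity, so lengths are measured in an affine plane that
  contains all of them. The theorem \<open>cross_ratio_eq\<close> below shows that the choices of this plane
  and of the orientation do not matter.
\<close>

definition cross_ratio ::
  "proj_point \<Rightarrow> proj_point \<Rightarrow> proj_point \<Rightarrow> proj_point \<Rightarrow> real option" where
  "cross_ratio A B C D =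
     (let f = (SOME f. \<forall>P\<in>{A, B, C, D}. finite_point f P);
          u = (SOME u. unit_direction u (affine_point f ` {A, B, C, D}))
      in affine_cross_ratio u (affine_point f A) (affine_point f B)
           (affine_point f C) (affine_point f D))"

lemma point_space_eq:
  assumes "v \<in> point_space P" "v \<noteq> 0" "w \<in> point_space P"
  shows "\<exists>c. w = c *\<^sub>R v"
proof -
  have P: "subspace (point_space P)" "dim (point_space P) = 1"
    using point_space[of P] by auto
  have "span {v} = span (point_space P)"
    using assms P by (intro dim_eq_span) (auto simp: dim_eq_card_independent)
  then have "w \<in> span {v}"
    using assms(3) by (simp add: span_base)
  then show ?thesis
    by (auto simp: span_singleton)
qed

lemma affine_point_eq:
  assumes "v \<in> point_space P" "f \<bullet> v \<noteq> 0"
  shows "affine_point f P = v /\<^sub>R (f \<bullet> v)"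
  unfolding affine_point_def
proof (rule the_equality)
  have "subspace (point_space P)"
    using point_space[of P] by auto
  then show "v /\<^sub>R (f \<bullet> v) \<in> point_space P \<and> f \<bullet> (v /\<^sub>R (f \<bullet> v)) = 1"
    using assms by (simp add: subspace_scale)
next
  fix w assume w: "w \<in> point_space P \<and> f \<bullet> w = 1"
  moreover have "v \<noteq> 0"
    using assms by auto
  ultimately obtain c where "w = c *\<^sub>R v"
    using point_space_eq assms by blast
  moreover from this w have "c * (f \<bullet> v) = 1"
    by simp
  then have "c = inverse (f \<bullet> v)"
    using assms(2) by (simp add: field_simps)
  ultimately show "w = v /\<^sub>R (f \<bullet> v)"
    by simp
qed

lemma affine_point_props:
  assumes "finite_point f P"
  shows "affine_point f P \<in> point_space P" "f \<bullet> affine_point f P = 1"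
proof -
  from assms obtain v where "v \<in> point_space P" "f \<bullet> v = 1"
    by (auto simp: finite_point_def)
  then show "affine_point f P \<in> point_space P" "f \<bullet> affine_point f P = 1"
    using affine_point_eq[of v P f] by auto
qed

lemma affine_cross_ratio_change:
  fixes f :: "real ^ 3"
  assumes f: "\<forall>P\<in>{A, B, C, D}. finite_point f P"
    and u: "unit_direction u (affine_point f ` {A, B, C, D})"
    and f': "\<forall>P\<in>{A, B, C, D}. finite_point f' P"
  shows "\<exists>u'. unit_direction u' (affine_point f' ` {A, B, C, D})"
    and "unit_direction u' (affine_point f' ` {A, B, C, D}) \<Longrightarrow>
      affine_cross_ratio u' (affine_point f' A) (affine_point f' B) (affine_point f' C) (affine_point f' D) =
      affine_cross_ratio u (affine_point f A) (affine_point f B) (affine_point f C) (affine_point f D)"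
proof -
  let ?S = "{A, B, C, D}"
  define x where "x = affine_point f"
  define y where "y = affine_point f'"
  define a where "a = x A"
  have uu: "u \<bullet> u = 1"
    using u by (simp add: unit_direction_def norm_eq_1)
  have "\<forall>P\<in>?S. \<exists>s. x P - a = s *\<^sub>R u"
    using u unfolding unit_direction_def x_def a_def by blast
  then obtain s where s: "x P - a = s P *\<^sub>R u" if "P \<in> ?S" for P
    by metis
  then have xs: "x P = a + s P *\<^sub>R u" if "P \<in> ?S" for P
    using that by (metis add.commute diff_add_cancel)
  define al where "al = f' \<bullet> a"
  define be where "be = f' \<bullet> u"
  define w where "w = al *\<^sub>R u - be *\<^sub>R a"
  define k where "k P = al + s P * be" for P
  have fx: "f \<bullet> x P = 1" "x P \<in> point_space P" if "P \<in> ?S" for P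
    using affine_point_props f that unfolding x_def by blast+
  have kf: "f' \<bullet> x P = k P" if "P \<in> ?S" for P
    unfolding xs[OF that] k_def al_def be_def by (simp add: inner_add_right)
  have k0: "k P \<noteq> 0" if P: "P \<in> ?S" for P
  proof
    assume "k P = 0"
    have y1: "f' \<bullet> y P = 1" "y P \<in> point_space P"
      using affine_point_props f' P unfolding y_def by blast+
    have "x P \<noteq> 0"
      using fx(1)[OF P] by auto
    then obtain c where "y P = c *\<^sub>R x P"
      using point_space_eq[OF fx(2)[OF P] _ y1(2)] by blast
    with y1(1) kf[OF P] \<open>k P = 0\<close> show False
      by simp
  qed
  have yP: "y P = x P /\<^sub>R k P" if "P \<in> ?S" for P
    using affine_point_eq[of "x P" P f'] fx that kf k0 unfolding y_def by auto
  have diff: "y Q - y P = ((s Q - s P) / (k P * k Q)) *\<^sub>R w" if P: "P \<in> ?S" and Q: "Q \<in> ?S" for P Q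
  proof -
    have "(k P * k Q) *\<^sub>R (y Q - y P) = k P *\<^sub>R x Q - k Q *\<^sub>R x P"
      using k0[OF P] k0[OF Q] by (simp add: yP[OF P] yP[OF Q] scaleR_diff_right mult.assoc mult.left_commute[of "k P" "k Q"])
    also have "\<dots> = (s Q - s P) *\<^sub>R w"
      unfolding xs[OF P] xs[OF Q] k_def w_def by (simp add: algebra_simps)
    finally have "(1 / (k P * k Q)) *\<^sub>R ((k P * k Q) *\<^sub>R (y Q - y P)) =
        (1 / (k P * k Q)) *\<^sub>R ((s Q - s P) *\<^sub>R w)"
      by simp
    then show ?thesis
      using k0[OF P] k0[OF Q] by simp
  qed
  have lx: "oriented_length u (x P) (x Q) = s Q - s P" if P: "P \<in> ?S" and Q: "Q \<in> ?S" for P Q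
    unfolding oriented_length_def xs[OF P] xs[OF Q]
    by (simp add: uu flip: scaleR_diff_left)
  have ly: "oriented_length u' (y P) (y Q) = (s Q - s P) / (k P * k Q) * (w \<bullet> u')"
    if P: "P \<in> ?S" and Q: "Q \<in> ?S" for P Q u'
    unfolding oriented_length_def diff[OF P Q] by simp
  have sA: "s A = 0"
    using s[of A] uu by (auto simp: a_def)
  show "\<exists>u'. unit_direction u' (affine_point f' ` ?S)"
  proof (cases "w = 0")
    case True
    then have "y Q - y P = 0 *\<^sub>R u" if "P \<in> ?S" "Q \<in> ?S" for P Q
      using diff[OF that] by simp
    then have "unit_direction u (y ` ?S)"
      using u unfolding unit_direction_def by blast
    then show ?thesis
      unfolding y_def by blast
  next
    case False
    then have "y Q - y P = ((s Q - s P) / (k P * k Q) * norm w) *\<^sub>R (w /\<^sub>R norm w)"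
      if "P \<in> ?S" "Q \<in> ?S" for P Q
      using diff[OF that] by simp
    moreover have "norm (w /\<^sub>R norm w) = 1"
      using False by simp
    ultimately have "unit_direction (w /\<^sub>R norm w) (y ` ?S)"
      unfolding unit_direction_def by blast
    then show ?thesis
      unfolding y_def by blast
  qed
  assume u': "unit_direction u' (affine_point f' ` ?S)"
  have "affine_cross_ratio u' (y A) (y B) (y C) (y D) = affine_cross_ratio u (x A) (x B) (x C) (x D)"
  proof (cases "\<forall>P\<in>?S. s P = 0")
    case True
    then show ?thesis
      unfolding affine_cross_ratio_def by (simp add: lx ly)
  next
    case False
    then obtain P where P: "P \<in> ?S" "s P \<noteq> 0"
      by blast
    have "f \<bullet> u = 0"
      using fx(1)[OF P(1)] fx(1)[of A] P(2) sA unfolding xs[OF P(1)] a_def[symmetric]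
      by (simp add: inner_add_right)
    then have "f \<bullet> w = - be"
      using fx(1)[of A] by (simp add: w_def a_def inner_diff_right)
    moreover have "al \<noteq> 0"
      using k0[of A] sA by (simp add: k_def)
    ultimately have "w \<noteq> 0"
      using uu by (auto simp: w_def)
    obtain t where t: "y P - y A = t *\<^sub>R u'"
      using u' P(1) unfolding unit_direction_def y_def by blast
    have "y P - y A \<noteq> 0"
      using diff[of A P] P sA k0[of A] k0[OF P(1)] \<open>w \<noteq> 0\<close> by simp
    moreover have "u' \<bullet> u' = 1"
      using u' by (simp add: unit_direction_def norm_eq_1)
    ultimately have "(y P - y A) \<bullet> u' \<noteq> 0"
      using t by auto
    then have K: "w \<bullet> u' \<noteq> 0"
      using diff[of A P] P by auto
    show ?thesis
      using K k0[of A] k0[of B] k0[of C] k0[of D]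
      unfolding affine_cross_ratio_def by (simp add: lx ly)
  qed
  then show "affine_cross_ratio u' (affine_point f' A) (affine_point f' B) (affine_point f' C) (affine_point f' D) =
      affine_cross_ratio u (affine_point f A) (affine_point f B) (affine_point f C) (affine_point f D)"
    by (simp add: x_def y_def)
qed

theorem cross_ratio_eq:
  assumes "\<forall>P\<in>{A, B, C, D}. finite_point f P"
    and "unit_direction u (affine_point f ` {A, B, C, D})"
  shows "cross_ratio A B C D =
    affine_cross_ratio u (affine_point f A) (affine_point f B) (affine_point f C) (affine_point f D)"
proof -
  define f' where "f' = (SOME f. \<forall>P\<in>{A, B, C, D}. finite_point f P)"
  have f': "\<forall>P\<in>{A, B, C, D}. finite_point f' P"
    unfolding f'_def by (rule someI) (fact assms(1))
  define u' where "u' = (SOME u. unit_direction u (affine_point f' ` {A, B, C, D}))"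
  have "unit_direction u' (affine_point f' ` {A, B, C, D})"
    unfolding u'_def by (rule someI_ex) (fact affine_cross_ratio_change(1)[OF assms f'])
  from affine_cross_ratio_change(2)[OF assms f' this] show ?thesis
    unfolding cross_ratio_def Let_def f'_def u'_def .
qed

end

theory Submission
  imports Defs
begin

text \<open>
  Points are represented by vectors and lines by normal vectors, so that joins and meets become
  cross products and concurrency and collinearity become the vanishing of a triple product \<open>[x, y, z]\<close>.
  The cross-ratio of \<open>A\<close>, \<open>B\<close> and the intersections of their line with lines of normals \<open>m\<close> and \<open>n\<close> is
  \<open>(m \<bullet> a)(n \<bullet> b) / ((m \<bullet> b)(n \<bullet> a))\<close>. In (iii) both numerators are \<open>- [a1, b1, c1] [a2, b2, c2]\<close>, so (iii)
  says that the denominators agree, \<open>[b2, b1, c1] [a1, a2, c2] = [b1, b2, c2] [a2, a1, c1]\<close> (both cross-ratios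
  being infinite if both sides vanish). The difference of the two sides is the triple product
  \<open>[a1 \<times> a2, b1 \<times> b2, c1 \<times> c2]\<close>, whose vanishing is (i). The triple product expressing (ii) is this one
  multiplied by \<open>[a1, b1, c1] [a2, b2, c2]\<close>. Finally, (i) is invariant under cyclic permutation of
  \<open>A\<close>, \<open>B\<close>, \<open>C\<close>, which turns (iii) into (iv) and (v).
\<close>

unbundle cross3_syntax

section \<open>Triple product identities\<close>

text \<open>With \<open>x\<close>, \<open>y\<close>, \<open>z\<close> as the rows of a matrix, the
  triple product is its determinant and \<open>n\<close> a kernel vector. Reading \<open>n\<close>
  as a normal gives the test for collinearity, reading it as a point the test for
  concurrency.\<close>

lemma triple_zero_iff:
  fixes x y z :: "real^3"
  shows "x \<bullet> (y \<times> z) = 0 \<longleftrightarrow> (\<exists>n. n \<noteq> 0 \<and> n \<bullet> x = 0 \<and> n \<bullet> y = 0 \<and> n \<bullet> z = 0)"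
proof -
  have "x \<bullet> (y \<times> z) = 0 \<longleftrightarrow> \<not> invertible (vector [x, y, z] :: real^3^3)"
    by (simp add: dot_cross_det invertible_det_nz)
  also have "\<dots> \<longleftrightarrow> (\<exists>n. n \<noteq> 0 \<and> (vector [x, y, z] :: real^3^3) *v n = 0)"
    by (auto simp: invertible_left_inverse matrix_left_invertible_ker)
  also have "\<dots> \<longleftrightarrow> (\<exists>n. n \<noteq> 0 \<and> n \<bullet> x = 0 \<and> n \<bullet> y = 0 \<and> n \<bullet> z = 0)"
    by (simp add: matrix_vector_mul_component vec_eq_iff forall_3 inner_commute)
  finally show ?thesis .
qed

lemma triple_rotate: "x \<bullet> (y \<times> z) = y \<bullet> (z \<times> x)" for x y z :: "real^3"
  by (metis cross_triple inner_commute)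

lemma triple_swap: "x \<bullet> (y \<times> z) = - (y \<bullet> (x \<times> z))" for x y z :: "real^3"
  by (metis cross_skew inner_minus_right triple_rotate)

text \<open>Shifting the products exposes \<open>(a \<times> b) \<times> (c \<times> d)\<close>,
  which expands as a combination of \<open>c\<close> and \<open>d\<close>.\<close>

lemma triple_cross_cross:
  fixes a b c d e f :: "real^3"
  shows "(a \<times> b) \<bullet> ((c \<times> d) \<times> (e \<times> f)) =
    (a \<bullet> (b \<times> d)) * (c \<bullet> (e \<times> f)) - (a \<bullet> (b \<times> c)) * (d \<bullet> (e \<times> f))"
proof -
  have "(a \<times> b) \<bullet> ((c \<times> d) \<times> (e \<times> f)) = ((a \<times> b) \<times> (c \<times> d)) \<bullet> (e \<times> f)"
    by (metis cross_triple inner_commute)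
  then show ?thesis
    unfolding cross_cross_det dot_cross_det[symmetric] by (simp only: inner_diff_left inner_scaleR_left)
qed

text \<open>Two sides of a triangle meet in their common vertex; the scalar is the determinant of
  the triangle.\<close>

lemma cross_cross_shared:
  fixes x y z :: "real^3"
  shows "(x \<times> y) \<times> (y \<times> z) = (x \<bullet> (y \<times> z)) *\<^sub>R y"
  unfolding cross_cross_det dot_cross_det[symmetric] by simp

text \<open>By \<open>triple_cross_cross\<close> the left-hand side is a difference of two products.
  Each of the four factors contains two sides of one of the triangles, so
  \<open>cross_cross_shared\<close> splits off \<open>?t1\<close> or \<open>?t2\<close>, and each
  product receives both once.\<close>

lemma triple_desargues:
  fixes a1 b1 c1 a2 b2 c2 :: "real^3"
  shows "((a1 \<times> b1) \<times> (a2 \<times> b2)) \<bullet> (((b1 \<times> c1) \<times> (b2 \<times> c2)) \<times> ((c1 \<times> a1) \<times> (c2 \<times> a2))) =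
    (a1 \<bullet> (b1 \<times> c1)) * (a2 \<bullet> (b2 \<times> c2)) * ((a1 \<times> a2) \<bullet> ((b1 \<times> b2) \<times> (c1 \<times> c2)))"
proof -
  let ?t1 = "a1 \<bullet> (b1 \<times> c1)" and ?t2 = "a2 \<bullet> (b2 \<times> c2)"
  have 1: "(a1 \<times> b1) \<bullet> ((a2 \<times> b2) \<times> (b2 \<times> c2)) = ?t2 * ((a1 \<times> b1) \<bullet> b2)"
    unfolding cross_cross_shared by simp
  have 2: "(b1 \<times> c1) \<bullet> ((c1 \<times> a1) \<times> (c2 \<times> a2)) = ?t1 * ((c2 \<times> a2) \<bullet> c1)"
    unfolding triple_rotate[of "c2 \<times> a2", symmetric] cross_cross_shared
    by (simp only: inner_scaleR_right triple_rotate[of a1])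
  have 3: "(a1 \<times> b1) \<bullet> ((a2 \<times> b2) \<times> (b1 \<times> c1)) = - (?t1 * ((a2 \<times> b2) \<bullet> b1))"
    unfolding triple_swap[of "a1 \<times> b1"] cross_cross_shared by simp
  have 4: "(b2 \<times> c2) \<bullet> ((c1 \<times> a1) \<times> (c2 \<times> a2)) = - (?t2 * ((c1 \<times> a1) \<bullet> c2))"
    unfolding triple_swap[of "b2 \<times> c2"] cross_cross_shared
    by (simp only: inner_scaleR_right triple_rotate[of a2])
  \<comment> \<open>Moving the pair \<open>b1\<close>, \<open>b2\<close> to the front before
    expanding produces the triple products left over in facts 1 to 4, up to order and sign.\<close>
  have 5: "(a1 \<times> a2) \<bullet> ((b1 \<times> b2) \<times> (c1 \<times> c2)) =
      (b1 \<bullet> (b2 \<times> a1)) * (a2 \<bullet> (c1 \<times> c2)) - (b1 \<bullet> (b2 \<times> a2)) * (a1 \<bullet> (c1 \<times> c2))"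
    using triple_swap[of "a1 \<times> a2" "b1 \<times> b2" "c1 \<times> c2"] triple_cross_cross[of b1 b2 a1 a2 c1 c2]
    by linarith
  have 6: "(a1 \<times> b1) \<bullet> b2 = b1 \<bullet> (b2 \<times> a1)" "(c2 \<times> a2) \<bullet> c1 = a2 \<bullet> (c1 \<times> c2)"
    "(a2 \<times> b2) \<bullet> b1 = - (b1 \<bullet> (b2 \<times> a2))" "(c1 \<times> a1) \<bullet> c2 = - (a1 \<bullet> (c1 \<times> c2))"
    by (simp_all add: cross3_simps)
  show ?thesis
    unfolding triple_cross_cross[of "a1 \<times> b1"] 1 2 3 4 5 6 by (simp add: algebra_simps)
qed

section \<open>Homogeneous coordinates of points and lines\<close>

text \<open>A relation rather than a function, because coordinates are determined only up to a
  nonzero factor: any vector that a cross product yields can then serve.\<close>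

definition represents :: "real^3 \<Rightarrow> proj_point \<Rightarrow> bool" where
  "represents p P \<longleftrightarrow> p \<noteq> 0 \<and> p \<in> point_space P"

definition normal_to :: "real^3 \<Rightarrow> proj_line \<Rightarrow> bool" where
  "normal_to n g \<longleftrightarrow> n \<noteq> 0 \<and> line_space g = {v. n \<bullet> v = 0}"

lemma subspace_point_space: "subspace (point_space P)"
  and dim_point_space: "dim (point_space P) = 1"
  using point_space[of P] by auto

lemma subspace_line_space: "subspace (line_space g)"
  and dim_line_space: "dim (line_space g) = 2"
  using line_space[of g] by auto

lemma represents_nonzero: "represents p P \<Longrightarrow> p \<noteq> 0"
  by (simp add: represents_def)

lemma represents_exists: "\<exists>p. represents p P"
  using dim_point_space[of P] dim_eq_0[of "point_space P"]
  unfolding represents_def by auto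

lemma point_space_represents:
  assumes "represents p P"
  shows "point_space P = span {p}"
  using assms point_space_eq[of p P] subspace_scale[OF subspace_point_space]
  unfolding represents_def span_singleton by blast

lemma represents_surj:
  assumes "p \<noteq> 0"
  shows "\<exists>P. represents p P"
proof -
  have "dim (span {p}) = 1"
    using assms by (simp add: dim_eq_card_independent)
  then have "point_space (Abs_proj_point (span {p})) = span {p}"
    by (simp add: Abs_proj_point_inverse)
  then show ?thesis
    unfolding represents_def using assms by (metis singletonI span_base)
qed

lemma dim_normal:
  fixes n :: "real^3"
  assumes "n \<noteq> 0"
  shows "dim {v. n \<bullet> v = 0} = 2"
  using dim_hyperplane[OF assms] by simp

lemma normal_to_surj:
  assumes "n \<noteq> 0"
  shows "\<exists>g. normal_to n g"
proof -
  have "line_space (Abs_proj_line {v. n \<bullet> v = 0}) = {v. n \<bullet> v = 0}"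
    using assms by (simp add: Abs_proj_line_inverse subspace_hyperplane dim_normal)
  then show ?thesis
    unfolding normal_to_def using assms by blast
qed

lemma normal_to_exists: "\<exists>n. normal_to n g"
proof -
  obtain n where "n \<noteq> 0" "span (line_space g) = {v. n \<bullet> v = 0}"
    using lowdim_eq_hyperplane[of "line_space g"] by (auto simp: dim_line_space)
  then show ?thesis
    unfolding normal_to_def using subspace_line_space span_eq_iff by metis
qed

lemma on_line_iff:
  assumes "represents p P" "normal_to n g"
  shows "on_line P g \<longleftrightarrow> n \<bullet> p = 0"
proof -
  have "point_space P \<subseteq> line_space g \<longleftrightarrow> p \<in> line_space g"
    unfolding point_space_represents[OF assms(1)]
    using span_minimal[OF _ subspace_line_space[of g], of "{p}"] span_base[of p "{p}"] by blast
  then show ?thesis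
    using assms(2) by (simp add: on_line_def normal_to_def)
qed

lemma cross_nonzero:
  assumes "represents a A" "represents b B" "A \<noteq> B"
  shows "a \<times> b \<noteq> 0"
proof
  assume "a \<times> b = 0"
  then obtain c where "b = c *\<^sub>R a"
    using represents_nonzero[OF assms(1)] represents_nonzero[OF assms(2)]
    unfolding cross_eq_0 collinear_lemma by blast
  then have "represents b A"
    using assms(1,2) subspace_scale[OF subspace_point_space] unfolding represents_def by blast
  then have "point_space A = point_space B"
    using assms(2) point_space_represents by simp
  then show False
    using assms(3) by (simp add: point_space_inject)
qed

text \<open>Both vectors are orthogonal to \<open>a \<times> b\<close>, so their span lies in
  \<open>?H\<close>, and their independence makes the dimensions agree. Dimension 2 also makes the
  \<open>Abs_proj_line\<close> in \<open>join\<close> meaningful.\<close>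

lemma normal_to_join:
  assumes a: "represents a A" and b: "represents b B" and "A \<noteq> B"
  shows "normal_to (a \<times> b) (join A B)"
proof -
  let ?H = "{v. (a \<times> b) \<bullet> v = 0}"
  have n: "a \<times> b \<noteq> 0"
    using cross_nonzero assms by blast
  then have "a \<noteq> b" "a \<noteq> 0" "b \<noteq> 0"
    by auto
  moreover have "a \<notin> span {b}"
    using n by (auto simp: span_singleton cross_mult_left)
  ultimately have "independent {a, b}" "a \<noteq> b"
    by (simp_all add: independent_insert)
  then have "dim {a, b} = 2"
    by (simp add: dim_eq_card_independent)
  have "span {a, b} = ?H"
  proof (rule subspace_dim_equal)
    show "span {a, b} \<subseteq> ?H"
      by (rule span_minimal) (auto simp: subspace_hyperplane dot_cross_self)
  qed (simp_all add: subspace_hyperplane dim_normal n \<open>dim {a, b} = 2\<close>)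
  moreover have "span (point_space A \<union> point_space B) = span {a, b}"
    unfolding point_space_represents[OF a] point_space_represents[OF b] insert_is_Un[of a "{b}"]
    by (simp only: span_Un span_span)
  ultimately have "line_space (join A B) = ?H"
    using n by (simp add: join_def Abs_proj_line_inverse subspace_hyperplane dim_normal)
  then show ?thesis
    using n by (simp add: normal_to_def)
qed

lemma normal_cross_nonzero:
  assumes "normal_to n g" "normal_to m h" "g \<noteq> h"
  shows "n \<times> m \<noteq> 0"
proof
  assume "n \<times> m = 0"
  then obtain c where c: "m = c *\<^sub>R n"
    using assms unfolding cross_eq_0 collinear_lemma normal_to_def by blast
  then have "line_space g = line_space h"
    using assms unfolding normal_to_def by auto
  then show False
    using assms(3) by (simp add: line_space_inject)
qed

text \<open>A vector orthogonal to both normals is parallel to their cross product, so the two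
  planes intersect in a one-dimensional space, as \<open>Abs_proj_point\<close> requires.\<close>

lemma represents_meet:
  assumes "normal_to n g" "normal_to m h" "g \<noteq> h"
  shows "represents (n \<times> m) (meet g h)"
proof -
  have nz: "n \<times> m \<noteq> 0"
    using normal_cross_nonzero assms by blast
  have "v \<in> span {n \<times> m}" if "n \<bullet> v = 0" "m \<bullet> v = 0" for v
  proof -
    \<comment> \<open>Both coefficients in the expansion of \<open>v \<times> (n \<times> m)\<close>
      along \<open>n\<close> and \<open>m\<close> vanish.\<close>
    have "(n \<times> m) \<times> v = 0"
      using that Lagrange[of v n m] cross_skew[of v "n \<times> m"] by (simp add: inner_commute)
    then obtain c where "v = c *\<^sub>R (n \<times> m)"
      using nz unfolding cross_eq_0 collinear_lemma by (metis scale_zero_left)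
    then show ?thesis
      by (simp add: span_base span_scale)
  qed
  then have "line_space g \<inter> line_space h = span {n \<times> m}"
    using assms unfolding normal_to_def by (auto simp: span_singleton dot_cross_self)
  moreover have "dim (span {n \<times> m}) = 1"
    using nz by (simp add: dim_eq_card_independent)
  ultimately have "point_space (meet g h) = span {n \<times> m}"
    by (simp add: meet_def Abs_proj_point_inverse)
  then show ?thesis
    using nz by (simp add: represents_def span_base)
qed

section \<open>Collinearity and concurrency as vanishing triple products\<close>

text \<open>Every line has a normal and every nonzero vector is the normal of a line, so a common
  line amounts to a nonzero vector orthogonal to all three points.\<close>

lemma collinear_points_iff:
  assumes "represents a A" "represents b B" "represents c C"
  shows "collinear_points A B C \<longleftrightarrow> a \<bullet> (b \<times> c) = 0"
proof -
  have "collinear_points A B C \<longleftrightarrow> (\<exists>n g. normal_to n g \<and> on_line A g \<and> on_line B g \<and> on_line C g)"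
    unfolding collinear_points_def using normal_to_exists by blast
  also have "\<dots> \<longleftrightarrow> (\<exists>n g. normal_to n g \<and> n \<bullet> a = 0 \<and> n \<bullet> b = 0 \<and> n \<bullet> c = 0)"
    using assms on_line_iff by blast
  also have "\<dots> \<longleftrightarrow> (\<exists>n. n \<noteq> 0 \<and> n \<bullet> a = 0 \<and> n \<bullet> b = 0 \<and> n \<bullet> c = 0)"
    using normal_to_surj normal_to_def by blast
  finally show ?thesis
    by (simp add: triple_zero_iff)
qed

text \<open>Dual to \<open>collinear_points_iff\<close>: the vector orthogonal to the three normals
  is now the common point.\<close>

lemma concurrent_lines_iff:
  assumes "normal_to n g" "normal_to m h" "normal_to l k"
  shows "concurrent_lines g h k \<longleftrightarrow> n \<bullet> (m \<times> l) = 0"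
proof -
  have "concurrent_lines g h k \<longleftrightarrow> (\<exists>p P. represents p P \<and> on_line P g \<and> on_line P h \<and> on_line P k)"
    unfolding concurrent_lines_def using represents_exists by blast
  also have "\<dots> \<longleftrightarrow> (\<exists>p P. represents p P \<and> p \<bullet> n = 0 \<and> p \<bullet> m = 0 \<and> p \<bullet> l = 0)"
    using assms on_line_iff unfolding inner_commute[of _ n] inner_commute[of _ m] inner_commute[of _ l]
    by blast
  also have "\<dots> \<longleftrightarrow> (\<exists>p. p \<noteq> 0 \<and> p \<bullet> n = 0 \<and> p \<bullet> m = 0 \<and> p \<bullet> l = 0)"
    using represents_surj represents_def by blast
  finally show ?thesis
    by (simp add: triple_zero_iff)
qed

section \<open>Cross-ratios in homogeneous coordinates\<close>

lemma finite_point_iff: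
  assumes "represents p P"
  shows "finite_point f P \<longleftrightarrow> f \<bullet> p \<noteq> 0"
proof
  assume "finite_point f P"
  then obtain v where "v \<in> span {p}" "f \<bullet> v = 1"
    using point_space_represents[OF assms] by (auto simp: finite_point_def)
  then show "f \<bullet> p \<noteq> 0"
    by (auto simp: span_singleton)
next
  assume "f \<bullet> p \<noteq> 0"
  then have "p /\<^sub>R (f \<bullet> p) \<in> point_space P" "f \<bullet> (p /\<^sub>R (f \<bullet> p)) = 1"
    using assms subspace_scale[OF subspace_point_space] by (auto simp: represents_def)
  then show "finite_point f P"
    unfolding finite_point_def by blast
qed

lemma affine_point_represents:
  assumes "represents p P" "f \<bullet> p \<noteq> 0"
  shows "affine_point f P = p /\<^sub>R (f \<bullet> p)"
  using assms affine_point_eq by (simp add: represents_def)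

text \<open>The vectors \<open>f\<close> that send a given point to infinity form a plane, and
  finitely many planes cannot cover the space, being negligible.\<close>

lemma finite_points_exist:
  assumes "finite S"
  shows "\<exists>f. \<forall>P\<in>S. finite_point f P"
proof -
  obtain r where r: "represents (r P) P" for P
    using represents_exists by metis
  have "negligible (\<Union>P\<in>S. {f. r P \<bullet> f = 0})"
    using assms r by (intro negligible_Union) (auto intro!: negligible_hyperplane simp: represents_def)
  then obtain f where "f \<notin> (\<Union>P\<in>S. {f. r P \<bullet> f = 0})"
    using non_negligible_UNIV by (metis UNIV_eq_I)
  then show ?thesis
    using finite_point_iff[OF r] by (auto simp: inner_commute)
qed

text \<open>In an affine plane given by \<open>f\<close>, \<open>AC/CB\<close> is
  \<open>\<beta> * fb / (\<alpha> * fa)\<close> and \<open>BD/DA\<close> is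
  \<open>\<gamma> * fa / (\<delta> * fb)\<close>, so the weights cancel. The infinite cases
  \<open>\<alpha> = 0\<close> and \<open>\<delta> = 0\<close> mean \<open>C = B\<close> and
  \<open>D = A\<close>.\<close>

lemma cross_ratio_represents:
  assumes a: "represents a A" and b: "represents b B" and AB: "A \<noteq> B"
    and c: "represents (\<alpha> *\<^sub>R a + \<beta> *\<^sub>R b) C" and d: "represents (\<gamma> *\<^sub>R a + \<delta> *\<^sub>R b) D"
  shows "cross_ratio A B C D =
    (if \<alpha> = 0 \<or> \<delta> = 0 then None else Some ((\<beta> * \<gamma>) / (\<alpha> * \<delta>)))"
proof -
  obtain f where f: "\<forall>P\<in>{A, B, C, D}. finite_point f P"
    using finite_points_exist[of "{A, B, C, D}"] by auto
  define fa fb fc fd where "fa = f \<bullet> a" and "fb = f \<bullet> b"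
    and "fc = f \<bullet> (\<alpha> *\<^sub>R a + \<beta> *\<^sub>R b)" and "fd = f \<bullet> (\<gamma> *\<^sub>R a + \<delta> *\<^sub>R b)"
  note defs = fa_def fb_def fc_def fd_def
  have nz: "fa \<noteq> 0" "fb \<noteq> 0" "fc \<noteq> 0" "fd \<noteq> 0"
    using f finite_point_iff a b c d unfolding defs by blast+
  have fcd: "fc = \<alpha> * fa + \<beta> * fb" "fd = \<gamma> * fa + \<delta> * fb"
    by (simp_all add: defs inner_add_right)
  \<comment> \<open>All four affine points have the form \<open>x + s *\<^sub>R w\<close>.\<close>
  define x where "x = affine_point f A"
  define w where "w = affine_point f B - x"
  have ab: "a = fa *\<^sub>R x" "b = fb *\<^sub>R (x + w)"
    using nz affine_point_represents[OF a] affine_point_represents[OF b]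
    by (simp_all add: x_def w_def defs)
  have A: "affine_point f A = x + 0 *\<^sub>R w" and B: "affine_point f B = x + 1 *\<^sub>R w"
    by (simp_all add: x_def w_def)
  have "\<alpha> *\<^sub>R a + \<beta> *\<^sub>R b = fc *\<^sub>R x + (\<beta> * fb) *\<^sub>R w"
    unfolding ab fcd by (simp add: algebra_simps)
  then have "affine_point f C = (fc *\<^sub>R x + (\<beta> * fb) *\<^sub>R w) /\<^sub>R fc"
    using affine_point_represents[OF c] nz unfolding fc_def by metis
  then have C: "affine_point f C = x + (\<beta> * fb / fc) *\<^sub>R w"
    using nz by (simp add: scaleR_add_right divide_inverse mult.commute)
  have "\<gamma> *\<^sub>R a + \<delta> *\<^sub>R b = fd *\<^sub>R x + (\<delta> * fb) *\<^sub>R w"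
    unfolding ab fcd by (simp add: algebra_simps)
  then have "affine_point f D = (fd *\<^sub>R x + (\<delta> * fb) *\<^sub>R w) /\<^sub>R fd"
    using affine_point_represents[OF d] nz unfolding fd_def by metis
  then have D: "affine_point f D = x + (\<delta> * fb / fd) *\<^sub>R w"
    using nz by (simp add: scaleR_add_right divide_inverse mult.commute)
  have "w \<noteq> 0"
  proof
    assume "w = 0"
    then have "a \<times> b = 0"
      by (simp add: ab cross_mult_left cross_mult_right)
    then show False
      using cross_nonzero[OF a b AB] by simp
  qed
  define u where "u = w /\<^sub>R norm w"
  have "norm u = 1"
    using \<open>w \<noteq> 0\<close> by (simp add: u_def)
  have param: "\<exists>s. affine_point f P = x + s *\<^sub>R w" if "P \<in> {A, B, C, D}" for P
    using that A B C D by blast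
  have "\<exists>t. affine_point f Q - affine_point f P = t *\<^sub>R u"
    if PQ: "P \<in> {A, B, C, D}" "Q \<in> {A, B, C, D}" for P Q
  proof -
    obtain s t where "affine_point f P = x + s *\<^sub>R w" "affine_point f Q = x + t *\<^sub>R w"
      using param[OF PQ(1)] param[OF PQ(2)] by blast
    then have "affine_point f Q - affine_point f P = (t - s) *\<^sub>R w"
      by (simp add: scaleR_left_diff_distrib)
    also have "\<dots> = ((t - s) * norm w) *\<^sub>R u"
      using \<open>w \<noteq> 0\<close> by (simp add: u_def)
    finally show ?thesis
      by blast
  qed
  then have "unit_direction u (affine_point f ` {A, B, C, D})"
    using \<open>norm u = 1\<close> unfolding unit_direction_def by blast
  from cross_ratio_eq[OF f this]
  have cr: "cross_ratio A B C D = affine_cross_ratio u (affine_point f A) (affine_point f B)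
      (affine_point f C) (affine_point f D)" .
  \<comment> \<open>The length of \<open>AB\<close> in the chosen affine plane, a common factor of
    all four oriented lengths.\<close>
  define L where "L = w \<bullet> u"
  have "L \<noteq> 0"
    using \<open>w \<noteq> 0\<close> by (simp add: L_def u_def)
  have len: "oriented_length u (x + s *\<^sub>R w) (x + t *\<^sub>R w) = (t - s) * L" for s t
    by (simp add: oriented_length_def L_def left_diff_distrib inner_diff_left)
  \<comment> \<open>\<open>A\<close> and \<open>B\<close> have parameters 0 and 1, so these are
    \<open>CB\<close> and \<open>BD\<close> in units of \<open>AB\<close>.\<close>
  have "1 - \<beta> * fb / fc = \<alpha> * fa / fc" "\<delta> * fb / fd - 1 = - (\<gamma> * fa / fd)"
    using nz by (simp_all add: fcd field_simps)
  then have lengths: "oriented_length u (affine_point f C) (affine_point f B) = \<alpha> * fa / fc * L"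
      "oriented_length u (affine_point f B) (affine_point f D) = - (\<gamma> * fa / fd) * L"
      "oriented_length u (affine_point f A) (affine_point f C) = \<beta> * fb / fc * L"
      "oriented_length u (affine_point f D) (affine_point f A) = - (\<delta> * fb / fd) * L"
    unfolding A B C D len by simp_all
  have "affine_cross_ratio u (affine_point f A) (affine_point f B) (affine_point f C) (affine_point f D) =
    (if \<alpha> * fa / fc * L = 0 \<or> - (\<delta> * fb / fd) * L = 0 then None
     else Some ((\<beta> * fb / fc * L) / (\<alpha> * fa / fc * L) * ((- (\<gamma> * fa / fd) * L) / (- (\<delta> * fb / fd) * L))))"
    unfolding affine_cross_ratio_def lengths ..
  also have "\<dots> = (if \<alpha> = 0 \<or> \<delta> = 0 then None else Some ((\<beta> * \<gamma>) / (\<alpha> * \<delta>)))"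
    using nz \<open>L \<noteq> 0\<close> by simp
  finally show ?thesis
    using cr by simp
qed

text \<open>The vector is the expansion of \<open>(a \<times> b) \<times> m\<close>. The last
  hypothesis puts \<open>A\<close> or \<open>B\<close> off \<open>g\<close>, so that
  \<open>g\<close> differs from the join.\<close>

lemma represents_meet_join:
  assumes a: "represents a A" and b: "represents b B" and "A \<noteq> B"
    and g: "normal_to m g" and "m \<bullet> a \<noteq> 0 \<or> m \<bullet> b \<noteq> 0"
  shows "represents (- (m \<bullet> b) *\<^sub>R a + (m \<bullet> a) *\<^sub>R b) (meet (join A B) g)"
proof -
  have n: "normal_to (a \<times> b) (join A B)"
    using normal_to_join assms by blast
  have "a \<in> line_space (join A B)" "b \<in> line_space (join A B)"
    using n unfolding normal_to_def by (simp_all add: dot_cross_self inner_commute)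
  then have "join A B \<noteq> g"
    using assms(5) g unfolding normal_to_def by auto
  moreover have "(a \<times> b) \<times> m = - (m \<bullet> b) *\<^sub>R a + (m \<bullet> a) *\<^sub>R b"
    using Lagrange[of m a b] cross_skew[of m "a \<times> b"] by (simp add: algebra_simps)
  ultimately show ?thesis
    using represents_meet[OF n g] by simp
qed

text \<open>In \<open>cross_ratio_represents\<close> the coefficients are
  \<open>- (m \<bullet> b)\<close>, \<open>m \<bullet> a\<close> and
  \<open>- (n \<bullet> b)\<close>, \<open>n \<bullet> a\<close>; the two signs cancel. Both meets
  are genuine because \<open>g\<close> misses \<open>A\<close> and \<open>h\<close> misses
  \<open>B\<close>.\<close>

lemma cross_ratio_meet_join:
  assumes "represents a A" "represents b B" "A \<noteq> B"
    and "normal_to m g" "m \<bullet> a \<noteq> 0" and "normal_to n h" "n \<bullet> b \<noteq> 0"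
  shows "cross_ratio A B (meet (join A B) g) (meet (join A B) h) =
    (if m \<bullet> b = 0 \<or> n \<bullet> a = 0 then None
     else Some ((m \<bullet> a) * (n \<bullet> b) / ((m \<bullet> b) * (n \<bullet> a))))"
  using cross_ratio_represents[OF assms(1-3) represents_meet_join[OF assms(1-4)]
      represents_meet_join[OF assms(1-3,6)]] assms(5,7)
  by simp

section \<open>Triangles and their perspectivities\<close>

lemma is_triangle_iff:
  assumes "represents a A" "represents b B" "represents c C"
  shows "is_triangle A B C \<longleftrightarrow> a \<bullet> (b \<times> c) \<noteq> 0"
  using collinear_points_iff[OF assms] by (simp add: is_triangle_def)

lemma is_triangle_rotate: "is_triangle A B C \<Longrightarrow> is_triangle B C A"
  unfolding is_triangle_def collinear_points_def by blast

lemma is_triangle_distinct: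
  assumes "is_triangle A B C"
  shows "A \<noteq> B" "B \<noteq> C" "A \<noteq> C"
proof -
  obtain a b c where r: "represents a A" "represents b B" "represents c C"
    using represents_exists by meson
  show "A \<noteq> B"
    using is_triangle_iff[of a A a B c C] r assms dot_cross_self(1) by metis
  show "B \<noteq> C"
    using is_triangle_iff[of a A b B b C] r assms by (metis cross_refl inner_zero_right)
  show "A \<noteq> C"
    using is_triangle_iff[of a A b B a C] r assms dot_cross_self(2) by metis
qed

lemma perspective_from_point_iff:
  assumes "represents a1 A1" "represents b1 B1" "represents c1 C1"
    and "represents a2 A2" "represents b2 B2" "represents c2 C2"
    and "A1 \<noteq> A2" "B1 \<noteq> B2" "C1 \<noteq> C2"
  shows "perspective_from_point A1 B1 C1 A2 B2 C2 \<longleftrightarrow>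
    (a1 \<times> a2) \<bullet> ((b1 \<times> b2) \<times> (c1 \<times> c2)) = 0"
  unfolding perspective_from_point_def
  using assms by (intro concurrent_lines_iff normal_to_join)

lemma perspective_from_point_rotate:
  "perspective_from_point A1 B1 C1 A2 B2 C2 \<longleftrightarrow> perspective_from_point B1 C1 A1 B2 C2 A2"
  unfolding perspective_from_point_def concurrent_lines_def by blast

text \<open>Distinct corresponding vertices and sides let cross products represent all joins and
  meets; the triangle determinants in \<open>triple_desargues\<close> are nonzero and can be divided
  out.\<close>

lemma desargues:
  assumes T1: "is_triangle A1 B1 C1" and T2: "is_triangle A2 B2 C2"
    and "A1 \<noteq> A2" "B1 \<noteq> B2" "C1 \<noteq> C2"
    and lines: "join A1 B1 \<noteq> join A2 B2" "join B1 C1 \<noteq> join B2 C2" "join C1 A1 \<noteq> join C2 A2"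
  shows "perspective_from_point A1 B1 C1 A2 B2 C2 \<longleftrightarrow> perspective_from_line A1 B1 C1 A2 B2 C2"
proof -
  obtain a1 b1 c1 a2 b2 c2 where r: "represents a1 A1" "represents b1 B1" "represents c1 C1"
    "represents a2 A2" "represents b2 B2" "represents c2 C2"
    using represents_exists by meson
  note d = is_triangle_distinct[OF T1] is_triangle_distinct[OF T2]
  have "normal_to (a1 \<times> b1) (join A1 B1)" "normal_to (b1 \<times> c1) (join B1 C1)"
    "normal_to (c1 \<times> a1) (join C1 A1)" "normal_to (a2 \<times> b2) (join A2 B2)"
    "normal_to (b2 \<times> c2) (join B2 C2)" "normal_to (c2 \<times> a2) (join C2 A2)"
    using r d by (simp_all add: normal_to_join)
  then have "perspective_from_line A1 B1 C1 A2 B2 C2 \<longleftrightarrow>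
      ((a1 \<times> b1) \<times> (a2 \<times> b2)) \<bullet> (((b1 \<times> c1) \<times> (b2 \<times> c2)) \<times> ((c1 \<times> a1) \<times> (c2 \<times> a2))) = 0"
    unfolding perspective_from_line_def using lines
    by (intro collinear_points_iff represents_meet)
  moreover have "a1 \<bullet> (b1 \<times> c1) \<noteq> 0" "a2 \<bullet> (b2 \<times> c2) \<noteq> 0"
    using T1 T2 r is_triangle_iff by blast+
  ultimately show ?thesis
    using assms r by (simp add: perspective_from_point_iff triple_desargues)
qed

text \<open>\<open>cross_ratio_meet_join\<close> applies because no vertex of a triangle lies on the
  opposite side, while \<open>A1 \<noteq> B2\<close> and \<open>A2 \<noteq> B1\<close> give the
  lines that carry the cross-ratios.\<close>

lemma perspective_from_point_iff_cross_ratio: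
  assumes T1: "is_triangle A1 B1 C1" and T2: "is_triangle A2 B2 C2"
    and "A1 \<noteq> A2" "B1 \<noteq> B2" "C1 \<noteq> C2" "A1 \<noteq> B2" "A2 \<noteq> B1"
  shows "perspective_from_point A1 B1 C1 A2 B2 C2 \<longleftrightarrow>
    cross_ratio A1 B2 (meet (join A1 B2) (join B1 C1)) (meet (join A1 B2) (join A2 C2)) =
    cross_ratio A2 B1 (meet (join A2 B1) (join B2 C2)) (meet (join A2 B1) (join A1 C1))"
proof -
  obtain a1 b1 c1 a2 b2 c2 where r: "represents a1 A1" "represents b1 B1" "represents c1 C1"
    "represents a2 A2" "represents b2 B2" "represents c2 C2"
    using represents_exists by meson
  note d = is_triangle_distinct[OF T1] is_triangle_distinct[OF T2]
  define t1 t2 where "t1 = (b1 \<times> c1) \<bullet> a1" and "t2 = (b2 \<times> c2) \<bullet> a2"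
  have t: "t1 \<noteq> 0" "t2 \<noteq> 0"
    using T1 T2 r is_triangle_iff unfolding t1_def t2_def by (auto simp: inner_commute)
  \<comment> \<open>These sides are taken against the cyclic order of the vertices, hence the
    signs.\<close>
  have s: "(a1 \<times> c1) \<bullet> b1 = - t1" "(a2 \<times> c2) \<bullet> b2 = - t2"
    unfolding t1_def t2_def by (simp_all add: cross3_simps)
  have n: "normal_to (b1 \<times> c1) (join B1 C1)" "normal_to (a1 \<times> c1) (join A1 C1)"
    "normal_to (b2 \<times> c2) (join B2 C2)" "normal_to (a2 \<times> c2) (join A2 C2)"
    using r d by (simp_all add: normal_to_join)
  \<comment> \<open>The factors of the two denominators: \<open>p\<close>, \<open>q\<close> for the
    first cross-ratio, \<open>p'\<close>, \<open>q'\<close> for the second.\<close>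
  define p q p' q' where "p = (b1 \<times> c1) \<bullet> b2" and "q = (a2 \<times> c2) \<bullet> a1"
    and "p' = (b2 \<times> c2) \<bullet> b1" and "q' = (a1 \<times> c1) \<bullet> a2"
  have "cross_ratio A1 B2 (meet (join A1 B2) (join B1 C1)) (meet (join A1 B2) (join A2 C2)) =
      (if p = 0 \<or> q = 0 then None else Some (t1 * - t2 / (p * q)))"
    unfolding p_def q_def using cross_ratio_meet_join[OF r(1) r(5) \<open>A1 \<noteq> B2\<close> n(1) _ n(4)] t s
    by (simp add: t1_def)
  moreover have "cross_ratio A2 B1 (meet (join A2 B1) (join B2 C2)) (meet (join A2 B1) (join A1 C1)) =
      (if p' = 0 \<or> q' = 0 then None else Some (t1 * - t2 / (p' * q')))"
    unfolding p'_def q'_def using cross_ratio_meet_join[OF r(4) r(2) \<open>A2 \<noteq> B1\<close> n(3) _ n(2)] t s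
    by (simp add: t2_def mult.commute)
  moreover have "(a1 \<times> a2) \<bullet> ((b1 \<times> b2) \<times> (c1 \<times> c2)) = p * q - p' * q'"
  proof -
    \<comment> \<open>With the pair \<open>a1\<close>, \<open>a2\<close> rotated to the end, the
      expansion contains exactly the four denominator factors, up to sign.\<close>
    have "(a1 \<times> a2) \<bullet> ((b1 \<times> b2) \<times> (c1 \<times> c2)) =
        (b1 \<bullet> (b2 \<times> c2)) * (c1 \<bullet> (a1 \<times> a2)) - (b1 \<bullet> (b2 \<times> c1)) * (c2 \<bullet> (a1 \<times> a2))"
      using triple_rotate[of "a1 \<times> a2" "b1 \<times> b2" "c1 \<times> c2"]
        triple_cross_cross[of b1 b2 c1 c2 a1 a2]
      by simp
    moreover have "b1 \<bullet> (b2 \<times> c2) = p'" "c1 \<bullet> (a1 \<times> a2) = - q'"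
      "b1 \<bullet> (b2 \<times> c1) = - p" "c2 \<bullet> (a1 \<times> a2) = q"
      unfolding p_def q_def p'_def q'_def by (simp_all add: cross3_simps)
    ultimately show ?thesis
      by simp
  qed
  moreover have "perspective_from_point A1 B1 C1 A2 B2 C2 \<longleftrightarrow>
      (a1 \<times> a2) \<bullet> ((b1 \<times> b2) \<times> (c1 \<times> c2)) = 0"
    using assms r by (simp add: perspective_from_point_iff)
  \<comment> \<open>The common numerator is nonzero, so two finite values agree exactly if
    \<open>p * q = p' * q'\<close>. If only one value is infinite, exactly one of these products
    vanishes, and both sides of the equivalence fail.\<close>
  ultimately show ?thesis
    using t by (auto simp: divide_eq_eq eq_divide_eq)
qed

theorem corollary11:
  fixes A1 B1 C1 A2 B2 C2 :: proj_point
  assumes "is_triangle A1 B1 C1" and "is_triangle A2 B2 C2"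
    and "A1 \<noteq> A2" and "B1 \<noteq> B2" and "C1 \<noteq> C2"
    and "join A1 B1 \<noteq> join A2 B2" and "join B1 C1 \<noteq> join B2 C2" and "join C1 A1 \<noteq> join C2 A2"
    and "A1 \<noteq> B2" and "A2 \<noteq> B1" and "B1 \<noteq> C2" and "B2 \<noteq> C1" and "C1 \<noteq> A2" and "C2 \<noteq> A1"
  defines "i \<equiv> perspective_from_point A1 B1 C1 A2 B2 C2"
    and "ii \<equiv> perspective_from_line A1 B1 C1 A2 B2 C2"
    and "iii \<equiv>
      (let A1' = meet (join A1 B2) (join B1 C1);
           B1' = meet (join A2 B1) (join A1 C1);
           A2' = meet (join A2 B1) (join B2 C2);
           B2' = meet (join A1 B2) (join A2 C2)
       in cross_ratio A1 B2 A1' B2' = cross_ratio A2 B1 A2' B1')"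
    and "iv \<equiv>
      (let B1' = meet (join B1 C2) (join C1 A1);
           C1' = meet (join B2 C1) (join B1 A1);
           B2' = meet (join B2 C1) (join C2 A2);
           C2' = meet (join B1 C2) (join B2 A2)
       in cross_ratio B1 C2 B1' C2' = cross_ratio B2 C1 B2' C1')"
    and "v \<equiv>
      (let C1' = meet (join C1 A2) (join A1 B1);
           A1' = meet (join C2 A1) (join C1 B1);
           C2' = meet (join C2 A1) (join A2 B2);
           A2' = meet (join C1 A2) (join C2 B2)
       in cross_ratio C1 A2 C1' A2' = cross_ratio C2 A1 C2' A1')"
  shows "(i \<longleftrightarrow> ii) \<and> (i \<longleftrightarrow> iii) \<and> (i \<longleftrightarrow> iv) \<and> (i \<longleftrightarrow> v)"
proof -
  note T1 = assms(1) and T2 = assms(2)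
  note rot = is_triangle_rotate[OF T1] is_triangle_rotate[OF T2]
  have "i \<longleftrightarrow> ii"
    unfolding i_def ii_def using assms(1-8) by (rule desargues)
  moreover have "i \<longleftrightarrow> iii"
    unfolding i_def iii_def Let_def
    using assms(1-14) by (intro perspective_from_point_iff_cross_ratio)
  moreover have "i \<longleftrightarrow> iv"
    \<comment> \<open>The fixed first argument makes this a single cyclic step, to the labelling
      \<open>B\<close>, \<open>C\<close>, \<open>A\<close>; two such steps serve for
      \<open>v\<close>.\<close>
    unfolding i_def iv_def Let_def perspective_from_point_rotate[of A1]
    using assms(1-14) rot by (intro perspective_from_point_iff_cross_ratio)
  moreover have "i \<longleftrightarrow> v"
    unfolding i_def v_def Let_def perspective_from_point_rotate[of A1] perspective_from_point_rotate[of B1]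
    using assms(1-14) rot[THEN is_triangle_rotate] by (intro perspective_from_point_iff_cross_ratio)
  ultimately show ?thesis
    by blast
qed

end
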